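(* Let $k$ be a commutative ring, $\mathcal{A}$ an associative $k$-algebra, $M$ an $\mathcal{A}$-bimodule, and $\phi:\mathcal{A}\otimes\mathcal{A}\to M$ a Hochschild 2-cocycle. If $\pi:M\to\mathcal{A}$ is a $\phi$-Rota-Baxter operator, then $M$ is an NS-algebra with the three multiplications $$m\succ n:=\pi(m)\cdot n,\qquad m\prec n:=m\cdot\pi(n),\qquad m\vee n:=\phi(\pi(m),\pi(n))\qquad (m,n\in M).$$
   Context: Algebras are not necessarily unital. A Hochschild 2-cocycle $\phi\in C^2(\mathcal{A},M)$ is a $k$-bilinear map $\phi:\mathcal{A}\times\mathcal{A}\to M$ with $a\cdot\phi(b,c)-\phi(ab,c)+\phi(a,bc)-\phi(a,b)\cdot c=0$ for all $a,b,c\in\mathcal{A}$. A $k$-linear map $\pi:M\to\mathcal{A}$ is a twisted Rota-Baxter operator, or $\phi$-Rota-Baxter operator, if $\pi(m)\pi(n)=\pi(\pi(m)\cdot n+m\cdot\pi(n))+\pi(\phi(\pi(m),\pi(n)))$ for all $m,n\in M$. An NS-algebra is a $k$-module $\mathcal{T}$ with three bilinear multiplications $\succ,\prec,\vee$ such that, with $x\times y:=x\succ y+x\prec y+x\vee y$, for all $x,y,z\in\mathcal{T}$: (1) $(x\prec y)\prec z=x\prec(y\succ z+y\prec z+y\vee z)$; (2) $(x\succ y)\prec z=x\succ(y\prec z)$; (3) $x\succ(y\succ z)=(x\succ y+x\prec y+x\vee y)\succ z$; (4) $x\succ(y\vee z)-(x\times y)\vee z+x\vee(y\times z)-(x\vee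 y)\prec z=0$. *)

theory Defs
  imports "HOL-Algebra.Module"
begin

(* Modules over k are those of HOL-Algebra.  The module record inherits the fields mult and one
   from the ring record; the locale module does not constrain them.  For an algebra A the field
   mult is used as the product (one is irrelevant, since algebras need not be unital); for a
   plain module both fields are ignored. *)

definition linear_map ::
  "('k, 'r) ring_scheme \<Rightarrow> ('k, 'v, 'a) module_scheme \<Rightarrow> ('k, 'w, 'b) module_scheme
    \<Rightarrow> ('v \<Rightarrow> 'w) \<Rightarrow> bool"
  where "linear_map k V W f \<longleftrightarrow>
    f \<in> carrier V \<rightarrow> carrier W \<and>
    (\<forall>x\<in>carrier V. \<forall>y\<in>carrier V. f (x \<oplus>\<^bsub>V\<^esub> y) = f x \<oplus>\<^bsub>W\<^esub> f y) \<and>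
    (\<forall>c\<in>carrier k. \<forall>x\<in>carrier V. f (c \<odot>\<^bsub>V\<^esub> x) = c \<odot>\<^bsub>W\<^esub> f x)"

definition bilinear_map ::
  "('k, 'r) ring_scheme \<Rightarrow> ('k, 'u, 'a) module_scheme \<Rightarrow> ('k, 'v, 'b) module_scheme
    \<Rightarrow> ('k, 'w, 'c) module_scheme \<Rightarrow> ('u \<Rightarrow> 'v \<Rightarrow> 'w) \<Rightarrow> bool"
  where "bilinear_map k U V W f \<longleftrightarrow>
    (\<forall>x\<in>carrier U. linear_map k V W (\<lambda>y. f x y)) \<and>
    (\<forall>y\<in>carrier V. linear_map k U W (\<lambda>x. f x y))"

locale assoc_algebra = module k A
  for k :: "('k, 'r) ring_scheme" (structure)
    and A :: "('k, 'a, 'b) module_scheme" (structure) +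
  assumes mult_bilinear: "bilinear_map k A A A (\<lambda>a b. a \<otimes>\<^bsub>A\<^esub> b)"
    and mult_assoc: "\<lbrakk>a \<in> carrier A; b \<in> carrier A; c \<in> carrier A\<rbrakk>
      \<Longrightarrow> (a \<otimes>\<^bsub>A\<^esub> b) \<otimes>\<^bsub>A\<^esub> c = a \<otimes>\<^bsub>A\<^esub> (b \<otimes>\<^bsub>A\<^esub> c)"

locale bimodule = A: assoc_algebra k A + M: module k M
  for k :: "('k, 'r) ring_scheme" (structure)
    and A :: "('k, 'a, 'b) module_scheme" (structure)
    and M :: "('k, 'm, 'c) module_scheme" (structure)
    and lact :: "'a \<Rightarrow> 'm \<Rightarrow> 'm" (infixr "\<rhd>" 70)
    and ract :: "'m \<Rightarrow> 'a \<Rightarrow> 'm" (infixl "\<lhd>" 70) +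
  assumes lact_bilinear: "bilinear_map k A M M (\<lambda>a m. a \<rhd> m)"
    and ract_bilinear: "bilinear_map k M A M (\<lambda>m a. m \<lhd> a)"
    and lact_assoc: "\<lbrakk>a \<in> carrier A; b \<in> carrier A; m \<in> carrier M\<rbrakk>
      \<Longrightarrow> (a \<otimes>\<^bsub>A\<^esub> b) \<rhd> m = a \<rhd> (b \<rhd> m)"
    and ract_assoc: "\<lbrakk>a \<in> carrier A; b \<in> carrier A; m \<in> carrier M\<rbrakk>
      \<Longrightarrow> m \<lhd> (a \<otimes>\<^bsub>A\<^esub> b) = (m \<lhd> a) \<lhd> b"
    and lact_ract: "\<lbrakk>a \<in> carrier A; b \<in> carrier A; m \<in> carrier M\<rbrakk>
      \<Longrightarrow> (a \<rhd> m) \<lhd> b = a \<rhd> (m \<lhd> b)"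
begin

(* Maps on the tensor product of A with itself over k are represented by k-bilinear maps. *)
definition hochschild_2_cocycle :: "('a \<Rightarrow> 'a \<Rightarrow> 'm) \<Rightarrow> bool"
  where "hochschild_2_cocycle \<phi> \<longleftrightarrow>
    bilinear_map k A A M \<phi> \<and>
    (\<forall>a\<in>carrier A. \<forall>b\<in>carrier A. \<forall>c\<in>carrier A.
      ((a \<rhd> \<phi> b c \<ominus>\<^bsub>M\<^esub> \<phi> (a \<otimes>\<^bsub>A\<^esub> b) c) \<oplus>\<^bsub>M\<^esub> \<phi> a (b \<otimes>\<^bsub>A\<^esub> c)) \<ominus>\<^bsub>M\<^esub> (\<phi> a b \<lhd> c)
        = \<zero>\<^bsub>M\<^esub>)"

definition twisted_rota_baxter :: "('a \<Rightarrow> 'a \<Rightarrow> 'm) \<Rightarrow> ('m \<Rightarrow> 'a) \<Rightarrow> bool"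
  where "twisted_rota_baxter \<phi> \<pi> \<longleftrightarrow>
    linear_map k M A \<pi> \<and>
    (\<forall>m\<in>carrier M. \<forall>n\<in>carrier M.
      \<pi> m \<otimes>\<^bsub>A\<^esub> \<pi> n
        = \<pi> ((\<pi> m \<rhd> n) \<oplus>\<^bsub>M\<^esub> (m \<lhd> \<pi> n)) \<oplus>\<^bsub>A\<^esub> \<pi> (\<phi> (\<pi> m) (\<pi> n)))"

end

locale NS_algebra = module k T
  for k :: "('k, 'r) ring_scheme" (structure)
    and T :: "('k, 't, 'b) module_scheme" (structure)
    and succ :: "'t \<Rightarrow> 't \<Rightarrow> 't" (infixl "\<succ>" 70)
    and prec :: "'t \<Rightarrow> 't \<Rightarrow> 't" (infixl "\<prec>" 70)
    and vee :: "'t \<Rightarrow> 't \<Rightarrow> 't" (infixl "\<curlyvee>" 70) +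
  fixes star :: "'t \<Rightarrow> 't \<Rightarrow> 't" (infixl "\<star>" 70)
  defines "x \<star> y \<equiv> (x \<succ> y \<oplus>\<^bsub>T\<^esub> x \<prec> y) \<oplus>\<^bsub>T\<^esub> x \<curlyvee> y"
  assumes succ_bilinear: "bilinear_map k T T T (\<lambda>x y. x \<succ> y)"
    and prec_bilinear: "bilinear_map k T T T (\<lambda>x y. x \<prec> y)"
    and vee_bilinear: "bilinear_map k T T T (\<lambda>x y. x \<curlyvee> y)"
    and prec_prec: "\<lbrakk>x \<in> carrier T; y \<in> carrier T; z \<in> carrier T\<rbrakk>
      \<Longrightarrow> (x \<prec> y) \<prec> z = x \<prec> (y \<star> z)"
    and succ_prec: "\<lbrakk>x \<in> carrier T; y \<in> carrier T; z \<in> carrier T\<rbrakk>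
      \<Longrightarrow> (x \<succ> y) \<prec> z = x \<succ> (y \<prec> z)"
    and succ_succ: "\<lbrakk>x \<in> carrier T; y \<in> carrier T; z \<in> carrier T\<rbrakk>
      \<Longrightarrow> x \<succ> (y \<succ> z) = (x \<star> y) \<succ> z"
    and vee_cocycle: "\<lbrakk>x \<in> carrier T; y \<in> carrier T; z \<in> carrier T\<rbrakk>
      \<Longrightarrow> ((x \<succ> (y \<curlyvee> z) \<ominus>\<^bsub>T\<^esub> (x \<star> y) \<curlyvee> z) \<oplus>\<^bsub>T\<^esub> x \<curlyvee> (y \<star> z))
            \<ominus>\<^bsub>T\<^esub> (x \<curlyvee> y) \<prec> z = \<zero>\<^bsub>T\<^esub>"

end

theory Submission
  imports Defs
begin

text \<open>
  The twisted Rota-Baxter identity says that \<open>\<pi>\<close> carries the total product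
  \<open>m \<star> n = \<pi> m \<rhd> n + m \<lhd> \<pi> n + \<phi> (\<pi> m) (\<pi> n)\<close> of \<open>M\<close> to the product of \<open>A\<close>.  Replacing
  \<open>\<pi> (m \<star> n)\<close> by \<open>\<pi> m \<otimes> \<pi> n\<close>, the first three NS-axioms become the bimodule axioms and the
  fourth becomes the cocycle condition, all evaluated at \<open>\<pi> x\<close>, \<open>\<pi> y\<close>, \<open>\<pi> z\<close>.
\<close>

lemma linear_map_closed:
  "linear_map k V W f \<Longrightarrow> x \<in> carrier V \<Longrightarrow> f x \<in> carrier W"
  by (auto simp: linear_map_def)

lemma linear_map_add:
  "linear_map k V W f \<Longrightarrow> x \<in> carrier V \<Longrightarrow> y \<in> carrier V
    \<Longrightarrow> f (x \<oplus>\<^bsub>V\<^esub> y) = f x \<oplus>\<^bsub>W\<^esub> f y"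
  by (simp add: linear_map_def)

lemma linear_map_id: "linear_map k V V (\<lambda>x. x)"
  by (simp add: linear_map_def)

lemma linear_map_compose:
  "linear_map k U V g \<Longrightarrow> linear_map k V W f \<Longrightarrow> linear_map k U W (\<lambda>x. f (g x))"
  by (auto simp: linear_map_def Pi_iff)

lemma bilinear_map_closed:
  "bilinear_map k U V W f \<Longrightarrow> x \<in> carrier U \<Longrightarrow> y \<in> carrier V \<Longrightarrow> f x y \<in> carrier W"
  unfolding bilinear_map_def by (blast intro: linear_map_closed)

text \<open>Bilinearity of all three products on \<open>M\<close> comes from here: each is an action
  or \<open>\<phi>\<close> with \<open>\<pi>\<close> or the identity put into each argument.\<close>

lemma bilinear_map_compose:
  assumes f: "bilinear_map k U' V' W f" and g: "linear_map k U U' g" and h: "linear_map k V V' h"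
  shows "bilinear_map k U V W (\<lambda>x y. f (g x) (h y))"
  unfolding bilinear_map_def
proof (intro conjI ballI)
  fix x assume "x \<in> carrier U"
  then have "linear_map k V' W (f (g x))"
    using f linear_map_closed[OF g] by (auto simp: bilinear_map_def)
  then show "linear_map k V W (\<lambda>y. f (g x) (h y))"
    by (rule linear_map_compose[OF h])
next
  fix y assume "y \<in> carrier V"
  then have "linear_map k U' W (\<lambda>u. f u (h y))"
    using f linear_map_closed[OF h] by (auto simp: bilinear_map_def)
  then show "linear_map k U W (\<lambda>x. f (g x) (h y))"
    by (rule linear_map_compose[OF g])
qed

theorem proposition3p8:
  fixes k :: "('k, 'r) ring_scheme"
    and A :: "('k, 'a, 'b) module_scheme"
    and M :: "('k, 'm, 'c) module_scheme"
    and lact :: "'a \<Rightarrow> 'm \<Rightarrow> 'm"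
    and ract :: "'m \<Rightarrow> 'a \<Rightarrow> 'm"
    and \<phi> :: "'a \<Rightarrow> 'a \<Rightarrow> 'm"
    and \<pi> :: "'m \<Rightarrow> 'a"
  assumes "bimodule k A M lact ract"
    and "bimodule.hochschild_2_cocycle k A M lact ract \<phi>"
    and "bimodule.twisted_rota_baxter k A M lact ract \<phi> \<pi>"
  shows "NS_algebra k M
    (\<lambda>m n. lact (\<pi> m) n)
    (\<lambda>m n. ract m (\<pi> n))
    (\<lambda>m n. \<phi> (\<pi> m) (\<pi> n))"
proof -
  interpret bimodule k A M lact ract by fact
  have \<phi>: "bilinear_map k A A M \<phi>"
    and cocycle: "\<And>a b c. a \<in> carrier A \<Longrightarrow> b \<in> carrier A \<Longrightarrow> c \<in> carrier A \<Longrightarrow>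
      ((lact a (\<phi> b c) \<ominus>\<^bsub>M\<^esub> \<phi> (a \<otimes>\<^bsub>A\<^esub> b) c) \<oplus>\<^bsub>M\<^esub> \<phi> a (b \<otimes>\<^bsub>A\<^esub> c)) \<ominus>\<^bsub>M\<^esub> ract (\<phi> a b) c
        = \<zero>\<^bsub>M\<^esub>"
    using assms(2) by (auto simp: hochschild_2_cocycle_def)
  have \<pi>: "linear_map k M A \<pi>"
    and rota_baxter: "\<And>m n. m \<in> carrier M \<Longrightarrow> n \<in> carrier M \<Longrightarrow>
      \<pi> m \<otimes>\<^bsub>A\<^esub> \<pi> n
        = \<pi> (lact (\<pi> m) n \<oplus>\<^bsub>M\<^esub> ract m (\<pi> n)) \<oplus>\<^bsub>A\<^esub> \<pi> (\<phi> (\<pi> m) (\<pi> n))"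
    using assms(3) by (auto simp: twisted_rota_baxter_def)
  note closed [simp] = linear_map_closed[OF \<pi>] bilinear_map_closed[OF \<phi>]
    bilinear_map_closed[OF lact_bilinear] bilinear_map_closed[OF ract_bilinear]
  \<comment> \<open>Additivity of \<open>\<pi>\<close> merges the two summands of
    \<open>rota_baxter\<close> into one value. The bracketing is that of \<open>\<star>\<close> in
    \<open>NS_algebra\<close>, and the equation is oriented to remove total products under
    \<open>\<pi>\<close>.\<close>
  have star [simp]: "\<pi> ((lact (\<pi> m) n \<oplus>\<^bsub>M\<^esub> ract m (\<pi> n)) \<oplus>\<^bsub>M\<^esub> \<phi> (\<pi> m) (\<pi> n)) = \<pi> m \<otimes>\<^bsub>A\<^esub> \<pi> n"
    if "m \<in> carrier M" "n \<in> carrier M" for m n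
    using that by (simp add: rota_baxter linear_map_add[OF \<pi>])
  show ?thesis
  proof (intro NS_algebra.intro NS_algebra_axioms.intro)
    show "module k M" by (rule M.module_axioms)
    show "bilinear_map k M M M (\<lambda>m n. lact (\<pi> m) n)"
      by (rule bilinear_map_compose[OF lact_bilinear \<pi> linear_map_id])
    show "bilinear_map k M M M (\<lambda>m n. ract m (\<pi> n))"
      by (rule bilinear_map_compose[OF ract_bilinear linear_map_id \<pi>])
    show "bilinear_map k M M M (\<lambda>m n. \<phi> (\<pi> m) (\<pi> n))"
      by (rule bilinear_map_compose[OF \<phi> \<pi> \<pi>])
  \<comment> \<open>The four NS identities remain. The second contains no total product and is
    \<open>lact_ract\<close> as it stands; in the others \<open>star\<close> first creates the
    products in \<open>A\<close> to which \<open>ract_assoc\<close>, \<open>lact_assoc\<close> and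
    \<open>cocycle\<close> apply.\<close>
  qed (simp_all add: ract_assoc lact_assoc lact_ract cocycle)
qed

end
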